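(* For all $0<a<1$ there exists an infinite proper subset $I\subset\mathbb{N}$ such that the box dimension of the continued fraction set $\Lambda_I$ does not exist (i.e. $\underline{\dim}_{\mathrm B}\Lambda_I<\overline{\dim}_{\mathrm B}\Lambda_I$), and $\Lambda_I\subset(0,a)$.
   Context: $\mathbb{N}=\{1,2,3,\dots\}$. For a non-empty proper subset $I\subset\mathbb{N}$, $$\Lambda_I=\left\{z\in(0,1)\setminus\mathbb{Q}: z=\cfrac{1}{b_1+\cfrac{1}{b_2+\cfrac{1}{\ddots}}},\ b_n\in I\text{ for all }n\in\mathbb{N}\right\}$$ is the set of irrationals in $(0,1)$ all of whose continued fraction digits lie in $I$. For a non-empty bounded set $E\subset\mathbb{R}$, $N_r(E)$ is the least number of open balls of radius $r$ required to cover $E$, and $\underline{\dim}_{\mathrm B}E=\liminf_{r\to0}\frac{\log N_r(E)}{\log(1/r)}$, $\overline{\dim}_{\mathrm B}E=\limsup_{r\to0}\frac{\log N_r(E)}{\log(1/r)}$; the box dimension exists if these coincide. *)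

theory Defs
  imports "HOL-Analysis.Analysis" "HOL-Library.Extended_Real" "HOL-Library.Liminf_Limsup"
begin

(* cf_convergent b n = 1/(b 0 + 1/(b 1 + ... + 1/b (n-1))), the n-th convergent of the
   continued fraction with digits b_(k+1) = b k: digit sequences are indexed from 0 here. *)
primrec cf_convergent :: "(nat \<Rightarrow> nat) \<Rightarrow> nat \<Rightarrow> real" where
  "cf_convergent b 0 = 0"
| "cf_convergent b (Suc n) = 1 / (real (b 0) + cf_convergent (\<lambda>k. b (Suc k)) n)"

(* The value of an infinite continued fraction is the limit of its convergents.
   Intended for non-empty proper subsets I of the positive integers {1..}. *)
definition cf_set :: "nat set \<Rightarrow> real set" where
  "cf_set I = {z \<in> {0<..<1} - \<rat>. \<exists>b. (\<forall>n. b n \<in> I) \<and> cf_convergent b \<longlonglongrightarrow> z}"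

(* For bounded E and r > 0 such a cover exists, so the minimum is attained. *)
definition covering_number :: "real \<Rightarrow> real set \<Rightarrow> nat" where
  "covering_number r E = (LEAST n. \<exists>C. finite C \<and> card C = n \<and> E \<subseteq> (\<Union>x\<in>C. ball x r))"

(* Box dimensions, for non-empty bounded E; extended reals so that liminf and limsup are total. *)
definition lower_box_dim :: "real set \<Rightarrow> ereal" where
  "lower_box_dim E =
     Liminf (at_right 0) (\<lambda>r. ereal (ln (real (covering_number r E)) / ln (1 / r)))"

definition upper_box_dim :: "real set \<Rightarrow> ereal" where
  "upper_box_dim E =
     Limsup (at_right 0) (\<lambda>r. ereal (ln (real (covering_number r E)) / ln (1 / r)))"

end

theory Submission
  imports Defs
begin

text \<open>
  Writing \<open>\<Lambda>\<close> for the continued fraction set, \<open>\<Lambda>\<close> is the union of its images under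
  \<open>x \<mapsto> 1/(b + x)\<close>, which contract by \<open>1/b\<^sup>2\<close>, and the images with \<open>b \<ge> 1/r\<close> lie in one ball of
  radius \<open>r\<close>. Hence \<open>N\<^sub>r(\<Lambda>) \<le> 1 + (\<Sum>b<1/r. N\<^bsub>b\<^sup>2r\<^esub>(\<Lambda>))\<close>, and if \<open>(\<Sum>b. b\<^bsup>-2s\<^esup>) \<le> 1/2\<close> then
  iterating gives \<open>N\<^sub>r(\<Lambda>) \<le> 2 (1 + m) r\<^bsup>-s\<^esup>\<close>, where \<open>m\<close> counts the digits below \<open>1/r\<close>.
  The digit set is a union of arithmetic progressions \<open>q\<^sup>2 + j q\<close> with \<open>j < q\<close>, for a sequence of
  lengths \<open>q\<close> growing so fast that \<open>m\<close> is negligible when \<open>1/r\<close> is the first digit of a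
  progression; there \<open>s = 3/10\<close> is admissible. On the other hand the \<open>q\<close> digits of a progression
  give points of \<open>\<Lambda>\<close> that are \<open>1/(4q\<^sup>3)\<close>-separated, so the upper box dimension is at least about
  \<open>1/3\<close>.
\<close>

section \<open>Covering numbers\<close>

lemma covering_number_le_card:
  assumes "finite C" "E \<subseteq> (\<Union>x\<in>C. ball x r)"
  shows "covering_number r E \<le> card C"
  unfolding covering_number_def by (rule Least_le) (use assms in blast)

text \<open>The \<open>LEAST\<close> in \<open>covering_number\<close> is attained only once some
  finite cover exists; total boundedness of the compact closure provides one.\<close>

lemma covering_number_cover:
  assumes "bounded E" "0 < r"
  obtains C where "finite C" "card C = covering_number r E" "E \<subseteq> (\<Union>x\<in>C. ball x r)"
proof -
  have "compact (closure E)"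
    using assms by (simp add: compact_closure)
  then obtain C where "finite C" "closure E \<subseteq> (\<Union>x\<in>C. ball x r)"
    using assms(2) compact_eq_totally_bounded by blast
  then have "\<exists>n C. finite C \<and> card C = n \<and> E \<subseteq> (\<Union>x\<in>C. ball x r)"
    using closure_subset by blast
  from LeastI_ex[OF this] show ?thesis
    unfolding covering_number_def[symmetric] using that by blast
qed

lemma covering_number_mono:
  assumes "E \<subseteq> F" "bounded F" "0 < r"
  shows "covering_number r E \<le> covering_number r F"
proof -
  obtain C where "finite C" "card C = covering_number r F" "F \<subseteq> (\<Union>x\<in>C. ball x r)"
    using covering_number_cover[OF assms(2,3)] .
  with assms(1) show ?thesis
    by (metis covering_number_le_card subset_trans)
qed

lemma covering_number_Un:
  assumes "bounded E" "bounded F" "0 < r"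
  shows "covering_number r (E \<union> F) \<le> covering_number r E + covering_number r F"
proof -
  obtain C where C: "finite C" "card C = covering_number r E" "E \<subseteq> (\<Union>x\<in>C. ball x r)"
    using covering_number_cover[OF assms(1,3)] .
  obtain D where D: "finite D" "card D = covering_number r F" "F \<subseteq> (\<Union>x\<in>D. ball x r)"
    using covering_number_cover[OF assms(2,3)] .
  have "covering_number r (E \<union> F) \<le> card (C \<union> D)"
    using C D by (intro covering_number_le_card) auto
  also have "\<dots> \<le> card C + card D"
    by (rule card_Un_le)
  finally show ?thesis
    using C D by simp
qed

lemma covering_number_UN:
  assumes "finite D" "\<And>b. b \<in> D \<Longrightarrow> bounded (F b)" "0 < r"
  shows "covering_number r (\<Union>b\<in>D. F b) \<le> (\<Sum>b\<in>D. covering_number r (F b))"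
  using assms
proof (induction D rule: finite_induct)
  case empty
  then show ?case
    using covering_number_le_card[of "{}" "{}"] by simp
next
  case (insert b D)
  have "covering_number r (F b \<union> (\<Union>b\<in>D. F b))
      \<le> covering_number r (F b) + covering_number r (\<Union>b\<in>D. F b)"
    using insert by (intro covering_number_Un) auto
  with insert show ?case
    by fastforce
qed

text \<open>\<open>f\<close> sends the centres of a cover to centres of a cover of the image. The
  bound is asked on \<open>{0..1}\<close> only, because the branches \<open>1 / (b + x)\<close> blow
  up near \<open>-b\<close>.\<close>

lemma covering_number_lipschitz_image:
  assumes E: "E \<subseteq> {0..1}" and r: "0 < r" and L: "0 < L"
    and f: "\<And>x y. x \<in> {0..1} \<Longrightarrow> y \<in> {0..1} \<Longrightarrow> \<bar>f x - f y\<bar> \<le> L * \<bar>x - y\<bar>"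
  shows "covering_number (L * r) (f ` E) \<le> covering_number r E"
proof -
  have "bounded E"
    using E bounded_closed_interval bounded_subset by blast
  then obtain C where C: "finite C" "card C = covering_number r E" "E \<subseteq> (\<Union>x\<in>C. ball x r)"
    using covering_number_cover r by blast
  text \<open>The centres of an optimal cover may lie outside the interval where \<open>f\<close> is controlled;
    moving them to the nearest point of it does no harm.\<close>
  define g where "g c = max 0 (min 1 c)" for c :: real
  have "f x \<in> (\<Union>c\<in>(\<lambda>c. f (g c)) ` C. ball c (L * r))" if "x \<in> E" for x
  proof -
    have "x \<in> (\<Union>c\<in>C. ball c r)"
      using C(3) that by blast
    then obtain c where c: "c \<in> C" "\<bar>x - c\<bar> < r"
      by (auto simp: dist_real_def abs_minus_commute)
    have x: "x \<in> {0..1}"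
      using E that by auto
    then have "\<bar>x - g c\<bar> \<le> \<bar>x - c\<bar>"
      by (auto simp: g_def)
    with c have "\<bar>x - g c\<bar> < r"
      by linarith
    then have "L * \<bar>x - g c\<bar> < L * r"
      using L by simp
    moreover have "\<bar>f x - f (g c)\<bar> \<le> L * \<bar>x - g c\<bar>"
      using x by (intro f) (auto simp: g_def)
    ultimately have "\<bar>f x - f (g c)\<bar> < L * r"
      by linarith
    with c(1) show ?thesis
      by (auto simp: dist_real_def abs_minus_commute)
  qed
  then have "covering_number (L * r) (f ` E) \<le> card ((\<lambda>c. f (g c)) ` C)"
    using C(1) by (intro covering_number_le_card) auto
  also have "\<dots> \<le> card C"
    using C(1) by (rule card_image_le)
  finally show ?thesis
    using C(2) by simp
qed

text \<open>An open ball of radius \<open>r\<close> has no two points at distance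
  \<open>2 * r\<close> or more, so separated points lie in balls with different centres.\<close>

lemma card_separated_le_covering_number:
  assumes "bounded E" "0 < r" "f ` J \<subseteq> E"
    and sep: "\<And>i j. i \<in> J \<Longrightarrow> j \<in> J \<Longrightarrow> i \<noteq> j \<Longrightarrow> 2 * r \<le> \<bar>f i - f j\<bar>"
  shows "card J \<le> covering_number r E"
proof -
  obtain C where C: "finite C" "card C = covering_number r E" "E \<subseteq> (\<Union>x\<in>C. ball x r)"
    using covering_number_cover[OF assms(1,2)] .
  have "\<exists>c. c \<in> C \<and> \<bar>c - f j\<bar> < r" if "j \<in> J" for j
    using that assms(3) C(3) by (fastforce simp: dist_real_def)
  then obtain h where h: "\<And>j. j \<in> J \<Longrightarrow> h j \<in> C \<and> \<bar>h j - f j\<bar> < r"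
    by metis
  have "inj_on h J"
  proof (rule inj_onI, rule ccontr)
    fix i j assume ij: "i \<in> J" "j \<in> J" "h i = h j" "i \<noteq> j"
    with h[of i] h[of j] sep[of i j] show False
      by linarith
  qed
  then have "card J \<le> card C"
    using h C(1) by (intro card_inj_on_le[of h]) auto
  then show ?thesis
    using C(2) by simp
qed

text \<open>One good scale below every \<open>e\<close> suffices, so the scale can be placed exactly
  where the digit set has a gap.\<close>

lemma lower_box_dim_le:
  assumes "\<And>e. 0 < e \<Longrightarrow>
    \<exists>r. 0 < r \<and> r < e \<and> ln (real (covering_number r E)) / ln (1 / r) \<le> c"
  shows "lower_box_dim E \<le> ereal c"
proof (rule ccontr)
  assume "\<not> ?thesis"
  then have "ereal c < lower_box_dim E"
    by simp
  then have "\<forall>\<^sub>F r in at_right 0. ereal c < ereal (ln (real (covering_number r E)) / ln (1 / r))"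
    unfolding lower_box_dim_def by (rule less_LiminfD)
  then obtain e where "0 < e"
    "\<And>r. 0 < r \<Longrightarrow> r < e \<Longrightarrow> c < ln (real (covering_number r E)) / ln (1 / r)"
    by (auto simp: eventually_at_right_field)
  with assms[of e] show False
    by force
qed

lemma upper_box_dim_ge:
  assumes "\<And>e. 0 < e \<Longrightarrow>
    \<exists>r. 0 < r \<and> r < e \<and> c \<le> ln (real (covering_number r E)) / ln (1 / r)"
  shows "ereal c \<le> upper_box_dim E"
proof (rule ccontr)
  assume "\<not> ?thesis"
  then have "upper_box_dim E < ereal c"
    by simp
  then have "\<forall>\<^sub>F r in at_right 0. ereal (ln (real (covering_number r E)) / ln (1 / r)) < ereal c"
    unfolding upper_box_dim_def by (rule Limsup_lessD)
  then obtain e where "0 < e"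
    "\<And>r. 0 < r \<Longrightarrow> r < e \<Longrightarrow> ln (real (covering_number r E)) / ln (1 / r) < c"
    by (auto simp: eventually_at_right_field)
  with assms[of e] show False
    by force
qed

section \<open>Continued fraction sets\<close>

lemma cf_convergent_bounds:
  assumes "\<And>n. 1 \<le> b n"
  shows "0 \<le> cf_convergent b n \<and> cf_convergent b n \<le> 1"
  using assms
proof (induction n arbitrary: b)
  case 0
  then show ?case by simp
next
  case (Suc n)
  have "0 \<le> cf_convergent (\<lambda>k. b (Suc k)) n" "1 \<le> real (b 0)"
    using Suc by (auto simp: numeral_eq_Suc)
  then show ?case
    by (simp add: field_simps)
qed

text \<open>Solving the recursion of the convergents for the tail shows that the shifted digit
  sequence converges to \<open>w = 1 / z - b 0\<close>.\<close>

lemma cf_set_decompose: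
  assumes "I \<subseteq> {1..}" "z \<in> cf_set I"
  obtains b w where "b \<in> I" "w \<in> cf_set I" "z = 1 / (real b + w)"
proof -
  obtain b where z: "0 < z" "z \<notin> \<rat>" and b: "\<And>n. b n \<in> I" "cf_convergent b \<longlonglongrightarrow> z"
    using assms(2) by (auto simp: cf_set_def)
  have b1: "1 \<le> b n" for n
    using b(1)[of n] assms(1) by auto
  define c where "c = cf_convergent (\<lambda>k. b (Suc k))"
  define w where "w = 1 / z - real (b 0)"
  have "(\<lambda>n. 1 / cf_convergent b (Suc n) - real (b 0)) \<longlonglongrightarrow> w"
    unfolding w_def using z(1)
    by (intro tendsto_intros LIMSEQ_Suc[OF b(2)]) auto
  then have lim: "c \<longlonglongrightarrow> w"
    by (simp add: c_def)
  have cb: "0 \<le> c n \<and> c n \<le> 1" for n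
    unfolding c_def using b1 by (intro cf_convergent_bounds)
  have zw: "z = 1 / (real (b 0) + w)"
    by (simp add: w_def)
  have "w \<notin> \<rat>"
    using z(2) zw by (metis Rats_1 Rats_add Rats_divide Rats_of_nat)
  moreover have "0 \<le> w" "w \<le> 1"
    using LIMSEQ_le_const[OF lim] LIMSEQ_le_const2[OF lim] cb by blast+
  \<comment> \<open>Limits of convergents are only known to lie in the closed unit interval;
    irrationality excludes its end points.\<close>
  moreover from calculation have "w \<noteq> 0" "w \<noteq> 1"
    by auto
  ultimately have "w \<in> cf_set I"
    using b(1) lim unfolding cf_set_def c_def
    by (auto intro!: exI[of _ "\<lambda>k. b (Suc k)"])
  with that b(1) zw show ?thesis
    by blast
qed

text \<open>The fixed point is a root of the monic polynomial \<open>x^2 + c * x - 1\<close>, so the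
  rational root test applies: in lowest terms \<open>m / n\<close>, first \<open>m = 1\<close> and
  then \<open>n = 1\<close>, against \<open>x < 1\<close>.\<close>

lemma no_rational_fixed_point:
  fixes x :: real
  assumes c: "1 \<le> c" and x: "0 < x" "x < 1" "x = 1 / (real c + x)"
  shows "x \<notin> \<rat>"
proof
  assume "x \<in> \<rat>"
  then obtain m n where mn: "n \<noteq> 0" "\<bar>x\<bar> = real m / real n" "coprime m n"
    using Rats_abs_nat_div_natE by blast
  then have xn: "x * real n = real m"
    using x by simp
  have "x * (real c + x) = 1"
    using x by (metis add_pos_nonneg less_irrefl nonzero_divide_eq_eq of_nat_0_le_iff add.commute)
  then have "(x * real n) * (real c * real n + x * real n) = real n * real n"
    by algebra
  then have "real (m * (c * n + m)) = real (n * n)"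
    unfolding xn by simp
  then have eq: "m * (c * n + m) = n * n"
    by (rule of_nat_eq_iff[THEN iffD1])
  then have "m dvd n * n"
    by (metis dvd_triv_left)
  then have "m = 1"
    using mn(3) by (metis coprime_dvd_mult_left_iff coprime_common_divisor_nat dvd_refl nat_dvd_1_iff_1)
  then have "(c * n + 1) = n * n"
    using eq by simp
  then have "n dvd 1"
    by (metis dvd_add_right_iff dvd_triv_right)
  then have "x = 1"
    using xn \<open>m = 1\<close> by simp
  with x show False
    by simp
qed

text \<open>\<open>x\<close> is fixed by \<open>y \<mapsto> 1 / (c + y)\<close>, which shrinks
  distances by a factor 4 because both denominators are at least 2.\<close>

lemma cf_convergent_constant:
  fixes x :: real
  assumes "2 \<le> c" "0 < x" "x = 1 / (real c + x)"
  shows "cf_convergent (\<lambda>_. c) \<longlonglongrightarrow> x"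
proof -
  let ?f = "cf_convergent (\<lambda>_. c)"
  have bound: "\<bar>?f n - x\<bar> \<le> x * (1/4) ^ n" for n
  proof (induction n)
    case 0
    then show ?case using assms by simp
  next
    case (Suc n)
    have f0: "0 \<le> ?f n"
      using cf_convergent_bounds[of "\<lambda>_. c"] assms(1) by simp
    have "?f (Suc n) - x = 1 / (real c + ?f n) - 1 / (real c + x)"
      using assms(3) by simp
    also have "\<dots> = (x - ?f n) / ((real c + ?f n) * (real c + x))"
      using f0 assms by (simp add: field_simps)
    finally have "\<bar>?f (Suc n) - x\<bar> = \<bar>?f n - x\<bar> / ((real c + ?f n) * (real c + x))"
      using f0 assms by (simp add: abs_mult abs_minus_commute)
    also have "\<dots> \<le> \<bar>?f n - x\<bar> / 4"
    proof (rule divide_left_mono)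
      show "4 \<le> (real c + ?f n) * (real c + x)"
        using mult_mono[of 2 "real c + ?f n" 2 "real c + x"] f0 assms by simp
      then show "0 < (real c + ?f n) * (real c + x) * 4"
        by simp
    qed simp
    also have "\<dots> \<le> x * (1/4) ^ Suc n"
      using Suc by simp
    finally show ?case .
  qed
  have "(\<lambda>n. x * (1/4) ^ n) \<longlonglongrightarrow> x * 0"
    by (intro tendsto_intros LIMSEQ_realpow_zero) auto
  then have "(\<lambda>n. ?f n - x) \<longlonglongrightarrow> 0"
    using bound by (intro Lim_null_comparison[of "\<lambda>n. ?f n - x"]) auto
  then show ?thesis
    by (simp add: LIM_zero_iff)
qed

text \<open>The witness has all digits but the first equal to \<open>c\<close>, so that its irrationality is that of
  a quadratic number.\<close>

lemma cf_set_points: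
  assumes I: "I \<subseteq> {2..}" and c: "c \<in> I"
  obtains x where "0 < x" "x < 1" "\<And>b. b \<in> I \<Longrightarrow> 1 / (real b + x) \<in> cf_set I"
proof -
  have c2: "2 \<le> c"
    using I c by auto
  \<comment> \<open>The positive root of \<open>x * (c + x) = 1\<close>, the value of the fraction
    with all digits \<open>c\<close>.\<close>
  define x where "x = (sqrt (real c ^ 2 + 4) - real c) / 2"
  have "sqrt (real c ^ 2 + 4) > real c"
    by (rule real_less_rsqrt) simp
  then have x0: "0 < x"
    by (simp add: x_def)
  have "sqrt (real c ^ 2 + 4) ^ 2 = real c ^ 2 + 4"
    by simp
  then have "x * (real c + x) = 1"
    unfolding x_def by (simp add: field_simps power2_eq_square)
  then have fx: "x = 1 / (real c + x)"
    using x0 by (simp add: field_simps)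
  have "1 / (real c + x) < 1"
    using x0 c2 by (simp add: field_simps)
  with fx have x1: "x < 1"
    by simp
  have irr: "x \<notin> \<rat>"
    using no_rational_fixed_point[of c x] c2 x0 x1 fx by simp
  have lim: "cf_convergent (\<lambda>_. c) \<longlonglongrightarrow> x"
    using cf_convergent_constant[OF c2 x0 fx] .
  have "1 / (real b + x) \<in> cf_set I" if b: "b \<in> I" for b
  proof -
    have b2: "2 \<le> b"
      using b I by auto
    define d where "d = case_nat b (\<lambda>_. c)"
    have "(\<lambda>n. 1 / (real b + cf_convergent (\<lambda>_. c) n)) \<longlonglongrightarrow> 1 / (real b + x)"
      using x0 by (intro tendsto_intros lim) simp
    then have "(\<lambda>n. cf_convergent d (Suc n)) \<longlonglongrightarrow> 1 / (real b + x)"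
      by (simp add: d_def)
    then have "cf_convergent d \<longlonglongrightarrow> 1 / (real b + x)"
      by (rule LIMSEQ_imp_Suc)
    moreover have "d n \<in> I" for n
      using b c by (simp add: d_def split: nat.split)
    moreover have "1 / (real b + x) \<notin> \<rat>"
    proof
      assume "1 / (real b + x) \<in> \<rat>"
      then have "1 / (1 / (real b + x)) - real b \<in> \<rat>"
        by (metis Rats_1 Rats_diff Rats_divide Rats_of_nat)
      with irr show False
        by simp
    qed
    moreover have "0 < 1 / (real b + x)" "1 / (real b + x) < 1"
      using b2 x0 by (auto simp: field_simps)
    ultimately show ?thesis
      unfolding cf_set_def by auto
  qed
  with that x0 x1 show ?thesis
    by blast
qed

section \<open>Recursive bounds for covering numbers of continued fraction sets\<close>

lemma bounded_cf_set: "bounded (cf_set I)"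
  by (rule bounded_subset[of "{0..1}"]) (auto simp: cf_set_def)

lemma covering_number_cf_set_ge_1:
  assumes "1 \<le> r"
  shows "covering_number r (cf_set I) \<le> 1"
  using covering_number_le_card[of "{0}" "cf_set I" r] assms
  by (force simp: cf_set_def dist_real_def)

text \<open>Splitting by the first digit: digits outside \<open>D\<close> give points in
  \<open>(0, r)\<close>, caught by one ball about 0, and the branch of each \<open>b\<close> in
  \<open>D\<close> contracts by \<open>1 / b^2\<close>.\<close>

lemma covering_number_cf_set_rec:
  assumes I: "I \<subseteq> {1..}" and D: "finite D" "D \<subseteq> I" and r: "0 < r"
    and far: "\<And>b. b \<in> I - D \<Longrightarrow> 1 / r \<le> real b"
  shows "covering_number r (cf_set I)
    \<le> 1 + (\<Sum>b\<in>D. covering_number (real b ^ 2 * r) (cf_set I))"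
proof -
  let ?F = "\<lambda>b. (\<lambda>w. 1 / (real b + w)) ` cf_set I"
  have D1: "1 \<le> real b" if "b \<in> D" for b
    using that D I by force
  have sub: "?F b \<subseteq> {0..1}" if "b \<in> D" for b
    using D1[OF that] by (auto simp: cf_set_def field_simps)
  have bd: "bounded (?F b)" if "b \<in> D" for b
    using sub[OF that] bounded_closed_interval bounded_subset by blast
  have "cf_set I \<subseteq> ball 0 r \<union> (\<Union>b\<in>D. ?F b)"
  proof
    fix z assume z: "z \<in> cf_set I"
    obtain b w where bw: "b \<in> I" "w \<in> cf_set I" "z = 1 / (real b + w)"
      using cf_set_decompose[OF I z] .
    show "z \<in> ball 0 r \<union> (\<Union>b\<in>D. ?F b)"
    proof (cases "b \<in> D")
      case True
      with bw show ?thesis by blast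
    next
      case False
      then have "1 / r \<le> real b"
        using far bw by blast
      \<comment> \<open>Positivity of \<open>w\<close> makes the bound strict, as the open ball
        requires.\<close>
      moreover have "0 < w"
        using bw by (simp add: cf_set_def)
      ultimately have "1 / r < real b + w"
        by linarith
      then have "1 / (real b + w) < 1 / (1 / r)"
        using r \<open>0 < w\<close> by (intro divide_strict_left_mono) auto
      then have "z < r"
        using bw(3) by simp
      moreover have "0 < z"
        using z by (simp add: cf_set_def)
      ultimately show ?thesis
        by simp
    qed
  qed
  then have "covering_number r (cf_set I) \<le> covering_number r (ball 0 r \<union> (\<Union>b\<in>D. ?F b))"
    using r D bd by (intro covering_number_mono) auto
  also have "\<dots> \<le> covering_number r (ball 0 r) + covering_number r (\<Union>b\<in>D. ?F b)"
    using r D bd by (intro covering_number_Un) auto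
  also have "\<dots> \<le> 1 + (\<Sum>b\<in>D. covering_number r (?F b))"
    using covering_number_le_card[of "{0}" "ball 0 r" r]
    by (intro add_mono covering_number_UN D bd r) auto
  also have "\<dots> \<le> 1 + (\<Sum>b\<in>D. covering_number (real b ^ 2 * r) (cf_set I))"
  proof (intro add_mono order_refl sum_mono)
    fix b assume b: "b \<in> D"
    let ?L = "1 / real b ^ 2"
    have lip: "\<bar>1 / (real b + x) - 1 / (real b + y)\<bar> \<le> ?L * \<bar>x - y\<bar>"
      if "x \<in> {0..1}" "y \<in> {0..1}" for x y
    proof -
      have pos: "0 < real b + x" "0 < real b + y"
        using that D1[OF b] by auto
      have "1 / (real b + x) - 1 / (real b + y) = (y - x) / ((real b + x) * (real b + y))"
        using pos by (simp add: field_simps)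
      then have "\<bar>1 / (real b + x) - 1 / (real b + y)\<bar>
          = \<bar>x - y\<bar> / ((real b + x) * (real b + y))"
        using pos by (simp add: abs_mult abs_minus_commute)
      also have "\<dots> \<le> \<bar>x - y\<bar> / real b ^ 2"
        using that D1[OF b] pos
        by (intro divide_left_mono) (auto simp: power2_eq_square intro!: mult_mono)
      finally show ?thesis
        by simp
    qed
    have "covering_number (?L * (real b ^ 2 * r)) (?F b) \<le> covering_number (real b ^ 2 * r) (cf_set I)"
      using D1[OF b] r lip
      by (intro covering_number_lipschitz_image) (auto simp: cf_set_def)
    then show "covering_number r (?F b) \<le> covering_number (real b ^ 2 * r) (cf_set I)"
      using D1[OF b] by simp
  qed
  finally show ?thesis .
qed

text \<open>Iterates the recursion with one fixed \<open>D\<close>: chosen for the smallest radius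
  \<open>r\<close>, it satisfies \<open>far\<close> at every larger radius too.\<close>

lemma covering_number_cf_set_le:
  assumes I: "I \<subseteq> {2..}" and D: "finite D" "D \<subseteq> I" and r: "0 < r" "r \<le> 1" and s: "0 \<le> s"
    and far: "\<And>b. b \<in> I - D \<Longrightarrow> 1 / r \<le> real b"
    and sum: "(\<Sum>b\<in>D. real b powr (- 2 * s)) \<le> 1 / 2"
  shows "real (covering_number r (cf_set I)) \<le> 2 * (1 + real (card D)) * r powr (- s)"
proof -
  let ?N = "\<lambda>R. real (covering_number R (cf_set I))"
  let ?A = "2 * (1 + real (card D))"
  have D2: "2 \<le> real b" if "b \<in> D" for b
    using that D I by force
  \<comment> \<open>Digits are at least 2, so each step enlarges the radius at least fourfold, and
    \<open>n\<close> bounds the steps until it exceeds 1. The condition \<open>r \<le> R\<close>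
    keeps \<open>D\<close> admissible.\<close>
  have main: "?N R \<le> ?A * R powr (- s)" if "r \<le> R" "R \<le> 1" "1 \<le> R * 4 ^ n" for R n
    using that
  proof (induction n arbitrary: R)
    case 0
    then have "R = 1"
      by simp
    with covering_number_cf_set_ge_1[of R I] show ?case
      by simp
  next
    case (Suc n)
    have R: "0 < R"
      using Suc r by linarith
    \<comment> \<open>The summand 1 accounts for radii that have grown past 1, where a single ball
      suffices.\<close>
    have step: "?N (real b ^ 2 * R) \<le> 1 + ?A * R powr (- s) * real b powr (- 2 * s)"
      if b: "b \<in> D" for b
    proof (cases "real b ^ 2 * R \<le> 1")
      case True
      have b4: "4 \<le> real b ^ 2"
        using power_mono[OF D2[OF b], of 2] by simp
      have "4 * R \<le> real b ^ 2 * R"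
        using b4 R by simp
      moreover from this have "r \<le> real b ^ 2 * R"
        using Suc.prems(1) R by linarith
      ultimately have "R * 4 ^ Suc n \<le> real b ^ 2 * R * 4 ^ n" "r \<le> real b ^ 2 * R"
        using mult_right_mono[of "4 * R" "real b ^ 2 * R" "4 ^ n"]
        by (simp_all add: mult.assoc mult.left_commute)
      with Suc.prems True have "?N (real b ^ 2 * R) \<le> ?A * (real b ^ 2 * R) powr (- s)"
        by (intro Suc.IH) auto
      also have "(real b ^ 2 * R) powr (- s) = R powr (- s) * real b powr (- 2 * s)"
      proof -
        have "real b ^ 2 = real b powr 2"
          using D2[OF b] by simp
        then have "(real b ^ 2) powr (- s) = real b powr (- 2 * s)"
          by (simp only: powr_powr) simp
        then show ?thesis
          using R by (simp add: powr_mult)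
      qed
      finally show ?thesis
        by (simp add: mult.assoc)
    next
      case False
      then have "?N (real b ^ 2 * R) \<le> 1"
        using covering_number_cf_set_ge_1[of "real b ^ 2 * R" I] by simp
      then show ?thesis
        by (rule order_trans) simp
    qed
    have "1 / R \<le> real b" if "b \<in> I - D" for b
    proof -
      have "1 / R \<le> 1 / r"
        using Suc.prems(1) r by (simp add: frac_le)
      with far[OF that] show ?thesis
        by linarith
    qed
    then have "covering_number R (cf_set I)
        \<le> 1 + (\<Sum>b\<in>D. covering_number (real b ^ 2 * R) (cf_set I))"
      using I by (intro covering_number_cf_set_rec D R) auto
    then have "?N R \<le> real (1 + (\<Sum>b\<in>D. covering_number (real b ^ 2 * R) (cf_set I)))"
      by (rule of_nat_mono)
    also have "\<dots> = 1 + (\<Sum>b\<in>D. ?N (real b ^ 2 * R))"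
      by simp
    also have "\<dots> \<le> 1 + (\<Sum>b\<in>D. 1 + ?A * R powr (- s) * real b powr (- 2 * s))"
      by (intro add_mono order_refl sum_mono step)
    also have "\<dots> = ?A / 2 + ?A * R powr (- s) * (\<Sum>b\<in>D. real b powr (- 2 * s))"
      by (simp add: sum.distrib sum_distrib_left)
    \<comment> \<open>The additive terms \<open>1 + card D\<close> are half of \<open>?A\<close> and
      are absorbed since \<open>R powr (- s) \<ge> 1\<close>; the hypothesis on the digit sum yields
      the other half.\<close>
    also have "\<dots> \<le> ?A / 2 * R powr (- s) + ?A * R powr (- s) * (1 / 2)"
    proof (intro add_mono mult_left_mono sum)
      have "1 \<le> R powr (- s)"
        using R Suc.prems(2) s powr_mono2'[of "- s" R 1] by simp
      then show "?A / 2 \<le> ?A / 2 * R powr (- s)"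
        using mult_left_mono[of 1 "R powr (- s)" "?A / 2"] by simp
    qed simp
    finally show ?case
      by (simp add: field_simps)
  qed
  obtain n where "1 / r < 4 ^ n"
    using real_arch_pow[of 4 "1 / r"] by auto
  then show ?thesis
    using r by (intro main[of r n]) (auto simp: field_simps)
qed

section \<open>Sparse unions of arithmetic progressions\<close>

text \<open>The progressions have length \<open>q = t\<^sup>5\<close>, so that their digits \<open>b \<ge> t\<^bsup>10\<^esup>\<close> satisfy
  \<open>b\<^bsup>-3/5\<^esup> \<le> t\<^bsup>-6\<^esup>\<close> with an integer exponent.\<close>

definition prog_root :: "nat \<Rightarrow> nat \<Rightarrow> nat" where
  "prog_root T k = T ^ (100 ^ k)"

definition prog_digit :: "nat \<Rightarrow> nat \<times> nat \<Rightarrow> nat" where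
  "prog_digit T = (\<lambda>(k, j). prog_root T k ^ 10 + j * prog_root T k ^ 5)"

text \<open>The parameter \<open>K\<close> cuts the full digit set \<open>K = UNIV\<close> into a
  finite head \<open>{..k}\<close>, which serves as \<open>D\<close> in the recursion, and a tail
  \<open>{Suc k..}\<close>.\<close>

definition prog_digits :: "nat \<Rightarrow> nat set \<Rightarrow> nat set" where
  "prog_digits T K = prog_digit T ` (SIGMA k:K. {..<prog_root T k ^ 5})"

text \<open>The factor 100 in the exponent creates the gaps: with \<open>t = prog_root T k\<close>,
  the head ends below \<open>2 * t^10\<close> and the tail begins at \<open>t^1000\<close>.\<close>

lemma prog_root_Suc: "prog_root T (Suc k) = prog_root T k ^ 100"
  by (simp add: prog_root_def power_mult[symmetric] mult.commute)

lemma prog_root_mono: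
  assumes "1 \<le> T" "i \<le> k"
  shows "prog_root T i \<le> prog_root T k"
  using assms by (simp add: prog_root_def power_increasing)

lemma prog_root_ge:
  assumes "1 \<le> T"
  shows "T ^ Suc k \<le> prog_root T k"
proof -
  have "Suc k \<le> 100 ^ k"
    by (induction k) auto
  then show ?thesis
    unfolding prog_root_def using assms by (intro power_increasing) auto
qed

text \<open>The last index is \<open>q - 1\<close> with \<open>q = prog_root T k ^ 5\<close>, which
  leaves room for one more \<open>q\<close>; this slack later absorbs the tail \<open>x < 1\<close>
  of a fraction.\<close>

lemma prog_digit_bounds:
  assumes "1 \<le> T" "j < prog_root T k ^ 5"
  shows "prog_root T k ^ 10 \<le> prog_digit T (k, j)"
    and "prog_digit T (k, j) + prog_root T k ^ 5 \<le> 2 * prog_root T k ^ 10"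
proof -
  have "Suc j * prog_root T k ^ 5 \<le> prog_root T k ^ 5 * prog_root T k ^ 5"
    using assms(2) by (intro mult_le_mono1) simp
  then show "prog_digit T (k, j) + prog_root T k ^ 5 \<le> 2 * prog_root T k ^ 10"
    by (simp add: prog_digit_def power_add[symmetric])
qed (simp add: prog_digit_def)

lemma finite_prog_digits: "finite K \<Longrightarrow> finite (prog_digits T K)"
  by (simp add: prog_digits_def)

lemma prog_digits_mono: "K \<subseteq> L \<Longrightarrow> prog_digits T K \<subseteq> prog_digits T L"
  unfolding prog_digits_def by (intro image_mono Sigma_mono) auto

lemma prog_digits_ge:
  assumes T: "1 \<le> T" and b: "b \<in> prog_digits T K" and K: "K \<subseteq> {k..}"
  shows "prog_root T k ^ 10 \<le> b"
proof -
  obtain i j where ij: "i \<in> K" "j < prog_root T i ^ 5" "b = prog_digit T (i, j)"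
    using b by (auto simp: prog_digits_def)
  have "prog_root T k ^ 10 \<le> prog_root T i ^ 10"
    using ij K T by (intro power_mono prog_root_mono) auto
  also have "\<dots> \<le> b"
    using prog_digit_bounds(1)[OF T ij(2)] ij by simp
  finally show ?thesis .
qed

lemma prog_digits_subset:
  assumes T: "2 \<le> T"
  shows "prog_digits T K \<subseteq> {T..}"
proof
  fix b assume "b \<in> prog_digits T K"
  then have "prog_root T 0 ^ 10 \<le> b"
    using prog_digits_ge[of T b K 0] T by auto
  moreover have "T \<le> prog_root T 0 ^ 10"
    using T by (simp add: prog_root_def self_le_power)
  ultimately show "b \<in> {T..}"
    by simp
qed

lemma infinite_prog_digits:
  assumes T: "2 \<le> T"
  shows "infinite (prog_digits T UNIV)"
  unfolding infinite_nat_iff_unbounded_le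
proof
  fix m
  have "prog_digit T (m, 0) \<in> prog_digits T UNIV"
    unfolding prog_digits_def using T by (intro imageI) (auto simp: prog_root_def)
  moreover have "m \<le> prog_digit T (m, 0)"
  proof -
    have "m < T ^ m"
      using T by (intro power_gt_expt) simp
    also have "T ^ m \<le> T ^ Suc m"
      using T by simp
    also have "\<dots> \<le> prog_root T m"
      using T by (intro prog_root_ge) simp
    also have "\<dots> \<le> prog_root T m ^ 10"
      using T by (intro self_le_power) (auto simp: prog_root_def)
    finally show ?thesis
      by (simp add: prog_digit_def)
  qed
  ultimately show "\<exists>n\<ge>m. n \<in> prog_digits T UNIV"
    by blast
qed

text \<open>Counts all positive integers below the end of the last progression; the resulting power
  \<open>t^10\<close> is small against the scale \<open>t^-1000\<close>.\<close>

lemma card_prog_digits_le: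
  assumes T: "1 \<le> T"
  shows "1 + card (prog_digits T {..k}) \<le> 2 * prog_root T k ^ 10"
proof -
  have pos: "0 < prog_root T i" for i
    using T by (simp add: prog_root_def)
  have "prog_digits T {..k} \<subseteq> {1..<2 * prog_root T k ^ 10}"
  proof
    fix b assume "b \<in> prog_digits T {..k}"
    then obtain i j where ij: "i \<le> k" "j < prog_root T i ^ 5" "b = prog_digit T (i, j)"
      by (auto simp: prog_digits_def)
    have "prog_root T i ^ 10 \<le> prog_root T k ^ 10"
      using ij T by (intro power_mono prog_root_mono) auto
    moreover have "0 < prog_root T i ^ 5" "0 < prog_root T i ^ 10"
      using pos by simp_all
    ultimately show "b \<in> {1..<2 * prog_root T k ^ 10}"
      unfolding atLeastLessThan_iff
      using prog_digit_bounds[OF T ij(2)] unfolding ij(3) by linarith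
  qed
  then have "card (prog_digits T {..k}) \<le> 2 * prog_root T k ^ 10 - 1"
    using card_mono[of "{1..<2 * prog_root T k ^ 10}"] by fastforce
  moreover have "0 < prog_root T k ^ 10"
    using pos by simp
  ultimately show ?thesis
    by linarith
qed

text \<open>A progression has \<open>t^5\<close> digits contributing at most \<open>t^-6\<close>
  each, hence at most \<open>1 / t\<close> in total, and these bounds are dominated by a geometric
  series.\<close>

lemma sum_prog_digits_le:
  assumes T: "4 \<le> T"
  shows "(\<Sum>b\<in>prog_digits T {..k}. real b powr (- 2 * (3 / 10))) \<le> 1 / 2"
proof -
  let ?t = "\<lambda>i. real (prog_root T i)"
  let ?S = "SIGMA i:{..k}. {..<prog_root T i ^ 5}"
  have pos: "0 < ?t i" for i
    using T by (simp add: prog_root_def)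
  \<comment> \<open>Summing over index pairs may count a digit repeatedly, which only enlarges the
    sum of nonnegative terms.\<close>
  have "(\<Sum>b\<in>prog_digits T {..k}. real b powr (- 2 * (3 / 10)))
      \<le> (\<Sum>p\<in>?S. real (prog_digit T p) powr (- 2 * (3 / 10)))"
    unfolding prog_digits_def
    using sum_image_le[of ?S "\<lambda>b. real b powr (- 2 * (3 / 10))" "prog_digit T"] by (simp add: o_def)
  also have "\<dots> \<le> (\<Sum>(i, j)\<in>?S. 1 / ?t i ^ 6)"
  proof (intro sum_mono, clarsimp)
    fix i j assume "i \<le> k" and j: "j < prog_root T i ^ 5"
    have "?t i ^ 10 \<le> real (prog_digit T (i, j))"
      using prog_digit_bounds(1)[OF _ j] T by (metis of_nat_le_iff of_nat_power le_trans one_le_numeral)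
    then have "real (prog_digit T (i, j)) powr (- (3 / 5)) \<le> (?t i ^ 10) powr (- (3 / 5))"
      using pos by (intro powr_mono2') auto
    also have "\<dots> = (?t i powr 10) powr (- (3 / 5))"
      using pos[of i] by simp
    also have "\<dots> = ?t i powr (- 6)"
      by (simp only: powr_powr) simp
    also have "\<dots> = 1 / ?t i ^ 6"
      using pos[of i] by (simp add: powr_minus_divide)
    finally show "real (prog_digit T (i, j)) powr (- (3 / 5)) \<le> 1 / ?t i ^ 6" .
  qed
  also have "\<dots> = (\<Sum>i\<le>k. \<Sum>j<prog_root T i ^ 5. 1 / ?t i ^ 6)"
    by (rule sum.Sigma[symmetric]) auto
  also have "\<dots> = (\<Sum>i\<le>k. 1 / ?t i)"
    using pos by (intro sum.cong) (simp_all add: field_simps power_add[symmetric] eval_nat_numeral)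
  \<comment> \<open>\<open>T \<ge> 4\<close> gives
    \<open>t \<ge> 4 ^ Suc i \<ge> 2 ^ (i + 2)\<close>; the shift by 2 makes the series sum to
    \<open>1 / 2\<close>.\<close>
  also have "\<dots> \<le> (\<Sum>i\<le>k. (1 / 2) ^ (i + 2))"
  proof (rule sum_mono)
    fix i
    have "(2::nat) ^ (i + 2) \<le> 4 ^ Suc i"
      using power_increasing[of "i + 2" "2 * Suc i" "2::nat"] by (simp add: power_mult)
    also have "\<dots> \<le> T ^ Suc i"
      using T by (intro power_mono) auto
    also have "\<dots> \<le> prog_root T i"
      using T by (intro prog_root_ge) simp
    finally have "2 ^ (i + 2) \<le> ?t i"
      by (metis of_nat_le_iff of_nat_numeral of_nat_power)
    then have "1 / ?t i \<le> 1 / 2 ^ (i + 2)"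
      by (intro divide_left_mono mult_pos_pos pos) auto
    then show "1 / ?t i \<le> (1 / 2) ^ (i + 2)"
      by (simp add: power_one_over)
  qed
  also have "\<dots> = 1 / 2 - (1 / 2) ^ (k + 2)"
    by (induction k) (simp_all add: field_simps power2_eq_square)
  also have "\<dots> \<le> 1 / 2"
    by simp
  finally show ?thesis .
qed

section \<open>The two box dimensions along selected scales\<close>

lemma inverse_prog_root_small:
  assumes "2 \<le> T" "0 < e"
  obtains k where "1 / real (prog_root T k) < e"
proof -
  obtain k where k: "1 / e < 2 ^ k"
    using real_arch_pow[of 2 "1 / e"] by auto
  have "(2::nat) ^ k \<le> T ^ Suc k"
    using assms(1) by (meson le_trans power_increasing power_mono le_SucI one_le_numeral order_refl zero_le)
  also have "\<dots> \<le> prog_root T k"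
    using assms(1) by (intro prog_root_ge) simp
  finally have "2 ^ k \<le> real (prog_root T k)"
    by (metis of_nat_le_iff of_nat_numeral of_nat_power)
  with k have "1 / e < real (prog_root T k)"
    by linarith
  moreover from this have "0 < real (prog_root T k)"
    using assms(2) by (meson less_trans zero_less_divide_1_iff)
  ultimately have "1 / real (prog_root T k) < e"
    using assms(2) by (simp add: field_simps)
  with that show ?thesis .
qed

text \<open>At \<open>r = t^-1000\<close> the exponent \<open>3/10\<close> contributes
  \<open>t^300\<close> and the size of the head at most \<open>t^11\<close>, whence
  \<open>311/1000\<close>.\<close>

lemma lower_box_dim_prog_digits:
  assumes T: "4 \<le> T"
  shows "lower_box_dim (cf_set (prog_digits T UNIV)) \<le> ereal (311 / 1000)"
proof (rule lower_box_dim_le)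
  fix e :: real assume "0 < e"
  let ?I = "prog_digits T UNIV"
  obtain k where k: "1 / real (prog_root T k) < e"
    using inverse_prog_root_small[of T e] T \<open>0 < e\<close> by auto
  define t where "t = real (prog_root T k)"
  have "T \<le> prog_root T k"
    using T prog_root_mono[of T 0 k] by (simp add: prog_root_def)
  then have t: "4 \<le> t"
    using T by (simp add: t_def)
  \<comment> \<open>\<open>1 / r\<close> is the first digit of the next progression, so every digit
    outside the head satisfies \<open>far\<close>.\<close>
  define r where "r = 1 / t ^ 1000"
  have "t ^ 1 \<le> t ^ 1000"
    using t by (intro power_increasing) auto
  then have "r \<le> 1 / t"
    using t by (simp add: r_def frac_le)
  then have r: "0 < r" "r < e" "r \<le> 1"
    using k t by (auto simp: t_def[symmetric] r_def)
  let ?D = "prog_digits T {..k}"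
  have far: "1 / r \<le> real b" if "b \<in> ?I - ?D" for b
  proof -
    have "b \<in> prog_digits T {Suc k..}"
    proof -
      have "prog_digits T UNIV = prog_digits T {..k} \<union> prog_digits T {Suc k..}"
        by (auto simp: prog_digits_def)
          (metis (no_types, lifting) SigmaI atMost_iff atLeast_iff image_eqI lessThan_iff
            not_less_eq_eq)
      with that show ?thesis by blast
    qed
    then have "prog_root T (Suc k) ^ 10 \<le> b"
      using T by (intro prog_digits_ge) auto
    then have "prog_root T k ^ 1000 \<le> b"
      by (simp add: prog_root_Suc power_mult[symmetric])
    then have "t ^ 1000 \<le> real b"
      unfolding t_def by (metis of_nat_le_iff of_nat_power)
    then show ?thesis
      by (simp add: r_def)
  qed
  let ?N = "real (covering_number r (cf_set ?I))"
  have "?N \<le> 2 * (1 + real (card ?D)) * r powr (- (3 / 10))"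
    using r far T sum_prog_digits_le[OF T, of k] prog_digits_subset[of T UNIV]
    by (intro covering_number_cf_set_le finite_prog_digits prog_digits_mono) auto
  also have "r powr (- (3 / 10)) = t ^ 300"
  proof -
    have "r = t powr (- 1000)"
      using t by (simp add: r_def powr_minus_divide)
    then have "r powr (- (3 / 10)) = t powr 300"
      by (simp only: powr_powr) simp
    then show ?thesis
      using t by simp
  qed
  also have "2 * (1 + real (card ?D)) \<le> t ^ 11"
  proof -
    have "real (1 + card ?D) \<le> real (2 * prog_root T k ^ 10)"
      using T card_prog_digits_le[of T k] by (intro of_nat_mono) auto
    then have "2 * (1 + real (card ?D)) \<le> 4 * t ^ 10"
      by (simp add: t_def)
    also have "\<dots> \<le> t * t ^ 10"
      using t by (intro mult_right_mono) auto
    finally show ?thesis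
      by (simp add: power_Suc[symmetric] del: power_Suc)
  qed
  finally have "?N \<le> t ^ 11 * t ^ 300"
    using t by simp
  then have N: "?N \<le> t ^ 311"
    by (simp add: power_add[symmetric])
  have "ln ?N \<le> 311 * ln t"
  \<comment> \<open>The default value \<open>ln 0 = 0\<close> settles the case of covering number
    zero.\<close>
  proof (cases "?N = 0")
    case True
    then show ?thesis using t by simp
  next
    case False
    then have "ln ?N \<le> ln (t ^ 311)"
      using N t by (subst ln_le_cancel_iff) auto
    then show ?thesis
      using t by (simp add: ln_realpow)
  qed
  moreover have "ln (1 / r) = 1000 * ln t"
    using t by (simp add: r_def ln_realpow)
  moreover have "0 < ln t"
    using t by simp
  ultimately have "ln ?N / ln (1 / r) \<le> 311 / 1000"
    by (simp add: field_simps)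
  with r show "\<exists>r. 0 < r \<and> r < e \<and>
      ln (real (covering_number r (cf_set ?I))) / ln (1 / r) \<le> 311 / 1000"
    by blast
qed

text \<open>One progression alone gives \<open>t^5\<close> separated points at a scale of order
  \<open>t^-15\<close>; the ratio \<open>5 * ln t / (ln 8 + 15 * ln t)\<close> falls short of
  \<open>1/3\<close> only through \<open>ln 8\<close>.\<close>

lemma upper_box_dim_prog_digits:
  assumes T: "64 \<le> T"
  shows "ereal (32 / 100) \<le> upper_box_dim (cf_set (prog_digits T UNIV))"
proof (rule upper_box_dim_ge)
  fix e :: real assume "0 < e"
  let ?I = "prog_digits T UNIV"
  obtain k where k: "1 / real (prog_root T k) < e"
    using inverse_prog_root_small[of T e] T \<open>0 < e\<close> by auto
  define t where "t = real (prog_root T k)"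
  have "T \<le> prog_root T k"
    using T prog_root_mono[of T 0 k] by (simp add: prog_root_def)
  then have t: "64 \<le> t"
    using T by (simp add: t_def)
  \<comment> \<open>Half of the guaranteed spacing: a digit gap \<open>t^5\<close> over a product of
    denominators at most \<open>4 * t^20\<close>.\<close>
  define r where "r = 1 / (8 * t ^ 15)"
  have "t ^ 1 \<le> t ^ 15"
    using t by (intro power_increasing) auto
  then have "t \<le> 8 * t ^ 15"
    using t by simp
  then have "r \<le> 1 / t"
    using t unfolding r_def by (intro frac_le) auto
  then have r: "0 < r" "r < e"
    using k t by (auto simp: t_def[symmetric] r_def)
  have I2: "?I \<subseteq> {2..}"
    using prog_digits_subset[of T UNIV] T by auto
  have "infinite ?I"
    using T by (intro infinite_prog_digits) simp
  then obtain c where "c \<in> ?I"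
    by fastforce
  then obtain x where x: "0 < x" "x < 1" "\<And>b. b \<in> ?I \<Longrightarrow> 1 / (real b + x) \<in> cf_set ?I"
    using cf_set_points[OF I2] by blast
  let ?J = "{..<prog_root T k ^ 5}"
  \<comment> \<open>All points share the tail \<open>x\<close>, so their differences come from the
    first digits alone.\<close>
  define f where "f j = 1 / (real (prog_digit T (k, j)) + x)" for j
  have digit: "real (prog_digit T (k, j)) = t ^ 10 + real j * t ^ 5" for j
    by (simp add: prog_digit_def t_def)
  have less: "2 * r \<le> f i - f j" if "i < j" "j \<in> ?J" for i j
  proof -
    let ?u = "real (prog_digit T (k, i)) + x" and ?v = "real (prog_digit T (k, j)) + x"
    have u0: "0 < ?u"
      using x by simp
    have diff: "t ^ 5 \<le> ?v - ?u"
    proof -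
      have "1 * t ^ 5 \<le> (real j - real i) * t ^ 5"
        using that t by (intro mult_right_mono) auto
      then show ?thesis
        by (simp add: digit algebra_simps)
    qed
    have "prog_digit T (k, j) + prog_root T k ^ 5 \<le> 2 * prog_root T k ^ 10"
      using that T by (intro prog_digit_bounds) auto
    then have "real (prog_digit T (k, j) + prog_root T k ^ 5) \<le> real (2 * prog_root T k ^ 10)"
      by (rule of_nat_mono)
    then have "real (prog_digit T (k, j)) + t ^ 5 \<le> 2 * t ^ 10"
      by (simp add: t_def)
    moreover have "1 \<le> t ^ 5"
      using t by simp
    ultimately have v: "?v \<le> 2 * t ^ 10"
      using x by linarith
    moreover have uv: "?u \<le> ?v"
      using diff \<open>1 \<le> t ^ 5\<close> by linarith
    ultimately have "?u * ?v \<le> (2 * t ^ 10) * (2 * t ^ 10)"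
      using u0 by (intro mult_mono) auto
    then have prod: "?u * ?v \<le> 4 * t ^ 20"
      by (simp add: power_add[symmetric])
    have "2 * r = t ^ 5 / (4 * t ^ 20)"
      using t by (simp add: r_def field_simps power_add[symmetric])
    also have "\<dots> \<le> (?v - ?u) / (?u * ?v)"
      using diff prod u0 uv t by (intro frac_le) auto
    also have "\<dots> = f i - f j"
      using u0 uv by (simp add: f_def field_simps)
    finally show ?thesis .
  qed
  have sep: "2 * r \<le> \<bar>f i - f j\<bar>" if "i \<in> ?J" "j \<in> ?J" "i \<noteq> j" for i j
    using less[of i j] less[of j i] that by (cases "i < j") auto
  have "f ` ?J \<subseteq> cf_set ?I"
    using x(3) by (auto simp: f_def prog_digits_def)
  then have "card ?J \<le> covering_number r (cf_set ?I)"
    using sep r by (intro card_separated_le_covering_number[where f = f] bounded_cf_set) auto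
  then have N: "t ^ 5 \<le> real (covering_number r (cf_set ?I))"
    unfolding t_def by (metis card_lessThan of_nat_le_iff of_nat_power)
  have "ln (t ^ 5) \<le> ln (real (covering_number r (cf_set ?I)))"
    using N t by (intro ln_mono) auto
  then have lnN: "5 * ln t \<le> ln (real (covering_number r (cf_set ?I)))"
    using t by (simp add: ln_realpow)
  \<comment> \<open>\<open>t \<ge> 64 = 8^2\<close> bounds \<open>ln 8\<close> by half of
    \<open>ln t\<close>, so \<open>32/100 * (ln 8 + 15 * ln t)\<close> is at most
    \<open>4.96 * ln t\<close>.\<close>
  have "2 * ln 8 = ln (64 :: real)"
    using ln_realpow[of 8 2] by simp
  also have "\<dots> \<le> ln t"
    using t by simp
  finally have "2 * ln 8 \<le> ln t" .
  moreover have lnr: "ln (1 / r) = ln 8 + 15 * ln t"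
    using t by (simp add: r_def ln_mult ln_realpow)
  moreover have "0 \<le> ln (8 :: real)"
    by simp
  ultimately have "32 / 100 * ln (1 / r) \<le> 5 * ln t"
    by linarith
  with lnN have "32 / 100 * ln (1 / r) \<le> ln (real (covering_number r (cf_set ?I)))"
    by linarith
  moreover have "0 < ln (1 / r)"
    using t unfolding lnr by (intro add_pos_nonneg) auto
  ultimately have "32 / 100 \<le> ln (real (covering_number r (cf_set ?I))) / ln (1 / r)"
    by (simp add: pos_le_divide_eq)
  with r show "\<exists>r. 0 < r \<and> r < e \<and>
      32 / 100 \<le> ln (real (covering_number r (cf_set ?I))) / ln (1 / r)"
    by blast
qed

theorem theorem4p6:
  fixes a :: real
  assumes "0 < a" and "a < 1"
  shows "\<exists>I :: nat set. I \<subset> {1..} \<and> infinite I \<and>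
           lower_box_dim (cf_set I) < upper_box_dim (cf_set I) \<and>
           cf_set I \<subseteq> {0<..<a}"
proof -
  obtain n :: nat where n: "1 / a < real n"
    using reals_Archimedean2 by blast
  \<comment> \<open>64 serves the dimension bounds \<open>311/1000 < 32/100\<close>;
    \<open>n\<close> pushes all digits above \<open>1 / a\<close>, which forces the set below
    \<open>a\<close>.\<close>
  define T where "T = max 64 n"
  have T: "64 \<le> T" "1 / a < real T"
    using n by (auto simp: T_def)
  let ?I = "prog_digits T UNIV"
  have sub: "?I \<subseteq> {T..}"
    using T by (intro prog_digits_subset) simp
  have "?I \<subseteq> {1..}" "1 \<notin> ?I"
    using sub T by auto
  then have "?I \<subset> {1..}"
    by auto
  moreover have "infinite ?I"
    using T by (intro infinite_prog_digits) simp
  moreover have "lower_box_dim (cf_set ?I) < upper_box_dim (cf_set ?I)"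
  proof -
    have "lower_box_dim (cf_set ?I) \<le> ereal (311 / 1000)"
      using T by (intro lower_box_dim_prog_digits) simp
    also have "\<dots> < ereal (32 / 100)"
      by simp
    also have "\<dots> \<le> upper_box_dim (cf_set ?I)"
      using T by (intro upper_box_dim_prog_digits)
    finally show ?thesis .
  qed
  moreover have "cf_set ?I \<subseteq> {0<..<a}"
  proof
    fix z assume z: "z \<in> cf_set ?I"
    obtain b w where bw: "b \<in> ?I" "w \<in> cf_set ?I" "z = 1 / (real b + w)"
      using cf_set_decompose[OF \<open>?I \<subseteq> {1..}\<close> z] .
    have "0 < w"
      using bw(2) by (simp add: cf_set_def)
    moreover have "real T \<le> real b"
      using bw(1) sub by auto
    ultimately have "1 / a < real b + w"
      using T by linarith
    then have "1 / (real b + w) < 1 / (1 / a)"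
      using assms(1) \<open>0 < w\<close> by (intro divide_strict_left_mono) auto
    then have "z < a"
      using bw(3) by simp
    moreover have "0 < z"
      using z by (simp add: cf_set_def)
    ultimately show "z \<in> {0<..<a}"
      by simp
  qed
  ultimately show ?thesis
    by blast
qed

end
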